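(* Let $n\ge 1$, let $G(J(P_n))=\{u_1,\dots,u_r\}$ and let $s\ge 2$. Let $i_1,\dots,i_s\in\{1,\dots,r\}$. The following statements are equivalent. (1) $u_{i_1}\cdots u_{i_s}\in G(J(P_n)^s)$. (2) $u_pu_q\in G(J(P_n)^2)$ for all $p,q\in\{i_1,\dots,i_s\}$.
   Context: Let $S=\Bbbk[x_1,\dots,x_n]$ be a polynomial ring over a field $\Bbbk$. For a monomial ideal $I$, $G(I)$ denotes its set of minimal monomial generators. $P_n$ is the path graph with vertices $x_1,\dots,x_n$ and edges $\{x_i,x_{i+1}\}$, $1\le i\le n-1$. The cover ideal of a finite simple graph $G$ is $J(G)=\bigcap_{\{x_i,x_j\}\in E(G)}(x_i,x_j)$ (equal to $(1)$ if $G$ has no edges); its minimal generators are the products of the variables in the minimal vertex covers of $G$. *)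

theory Defs
  imports "HOL-Library.Poly_Mapping" "HOL-Algebra.Ideal_Product"
begin

text \<open>A polynomial is a finitely supported map from exponent vectors to coefficients, with the
  convolution product of \<^theory>\<open>HOL-Library.Poly_Mapping\<close>. The variables are indexed by natural
  numbers, and the polynomial ring in the variables \<open>x\<^sub>v\<close>, \<open>v \<in> V\<close>, is cut out by its carrier.\<close>

type_synonym 'k mpoly = "(nat \<Rightarrow>\<^sub>0 nat) \<Rightarrow>\<^sub>0 'k"

definition monom :: "(nat \<Rightarrow>\<^sub>0 nat) \<Rightarrow> 'k::field mpoly"
  where "monom a = Poly_Mapping.single a 1"

definition var :: "nat \<Rightarrow> 'k::field mpoly"
  where "var v = monom (Poly_Mapping.single v 1)"

definition monomials :: "nat set \<Rightarrow> 'k::field mpoly set"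
  where "monomials V = monom ` {a. Poly_Mapping.keys a \<subseteq> V}"

definition mpoly_ring :: "nat set \<Rightarrow> 'k::field mpoly ring"
  where "mpoly_ring V =
    \<lparr>carrier = {p. \<forall>a\<in>Poly_Mapping.keys p. Poly_Mapping.keys a \<subseteq> V},
     mult = (*), one = 1, zero = 0, add = (+)\<rparr>"

definition is_min_gens :: "nat set \<Rightarrow> 'k::field mpoly set \<Rightarrow> 'k mpoly set \<Rightarrow> bool"
  where "is_min_gens V I B \<longleftrightarrow> B \<subseteq> monomials V \<and> Idl\<^bsub>mpoly_ring V\<^esub> B = I \<and>
    (\<forall>B'. B' \<subset> B \<longrightarrow> Idl\<^bsub>mpoly_ring V\<^esub> B' \<noteq> I)"

text \<open>The minimal monomial generators of a monomial ideal; \<open>ex1_is_min_gens\<close> below shows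
  that the description is well defined.\<close>

definition min_gens :: "nat set \<Rightarrow> 'k::field mpoly set \<Rightarrow> 'k mpoly set"
  where "min_gens V I = (THE B. is_min_gens V I B)"

definition ideal_power :: "nat set \<Rightarrow> 'k::field mpoly set \<Rightarrow> nat \<Rightarrow> 'k mpoly set"
  where "ideal_power V I s = I [^]\<^bsub>ideals_set (mpoly_ring V)\<^esub> s"

text \<open>Graphs are given by a vertex set \<open>V\<close> and a set \<open>E\<close> of two-element subsets of \<open>V\<close>. Intersecting
  with the carrier gives the unit ideal when there are no edges.\<close>

definition cover_ideal :: "nat set \<Rightarrow> nat set set \<Rightarrow> 'k::field mpoly set"
  where "cover_ideal V E =
    carrier (mpoly_ring V) \<inter> (\<Inter>e\<in>E. Idl\<^bsub>mpoly_ring V\<^esub> (var ` e))"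

definition path_edges :: "nat \<Rightarrow> nat set set"
  where "path_edges n = {{i, i + 1} | i. 1 \<le> i \<and> i \<le> n - 1}"

definition path_cover_ideal :: "nat \<Rightarrow> 'k::field mpoly set"
  where "path_cover_ideal n = cover_ideal {1..n} (path_edges n)"


lemma keys_add_nat:
  "Poly_Mapping.keys (a + b) = Poly_Mapping.keys a \<union> Poly_Mapping.keys b" for a b :: "nat \<Rightarrow>\<^sub>0 nat"
  by (auto simp: in_keys_iff lookup_add)

lemma cring_mpoly_ring: "cring (mpoly_ring V :: 'k::field mpoly ring)"
proof (rule cringI)
  show "abelian_group (mpoly_ring V :: 'k mpoly ring)"
  proof (rule abelian_groupI)
    fix p :: "'k mpoly" assume "p \<in> carrier (mpoly_ring V)"
    then show "\<exists>q\<in>carrier (mpoly_ring V). q \<oplus>\<^bsub>mpoly_ring V\<^esub> p = \<zero>\<^bsub>mpoly_ring V\<^esub>"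
      by (intro bexI[of _ "- p"]) (auto simp: mpoly_ring_def)
  next
    fix p q :: "'k mpoly" assume "p \<in> carrier (mpoly_ring V)" "q \<in> carrier (mpoly_ring V)"
    then show "p \<oplus>\<^bsub>mpoly_ring V\<^esub> q \<in> carrier (mpoly_ring V)"
      using Poly_Mapping.keys_add[of p q] by (auto simp: mpoly_ring_def)
  qed (auto simp: mpoly_ring_def algebra_simps)
  show "comm_monoid (mpoly_ring V :: 'k mpoly ring)"
  proof (rule comm_monoidI)
    fix p q :: "'k mpoly" assume pq: "p \<in> carrier (mpoly_ring V)" "q \<in> carrier (mpoly_ring V)"
    have "Poly_Mapping.keys c \<subseteq> V" if "c \<in> Poly_Mapping.keys (p * q)" for c
    proof -
      from that Poly_Mapping.keys_mult[of p q] obtain a b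
        where "c = a + b" "a \<in> Poly_Mapping.keys p" "b \<in> Poly_Mapping.keys q" by blast
      with pq show ?thesis by (simp add: keys_add_nat mpoly_ring_def)
    qed
    then show "p \<otimes>\<^bsub>mpoly_ring V\<^esub> q \<in> carrier (mpoly_ring V)" by (simp add: mpoly_ring_def)
  qed (auto simp: mpoly_ring_def algebra_simps)
qed (auto simp: mpoly_ring_def algebra_simps)

lemma monomials_carrier: "monomials V \<subseteq> carrier (mpoly_ring V)"
  by (auto simp: monomials_def monom_def mpoly_ring_def)

text \<open>A polynomial lies in a monomial ideal iff each of its terms is divisible by a generator.\<close>

lemma Idl_monom_image:
  fixes H :: "(nat \<Rightarrow>\<^sub>0 nat) set"
  assumes H: "\<And>h. h \<in> H \<Longrightarrow> Poly_Mapping.keys h \<subseteq> V"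
  shows "Idl\<^bsub>mpoly_ring V\<^esub> (monom ` H) =
    {p \<in> carrier (mpoly_ring V :: 'k::field mpoly ring).
       \<forall>a\<in>Poly_Mapping.keys p. \<exists>h\<in>H. \<exists>d. a = h + d}" (is "_ = ?M")
proof -
  let ?R = "mpoly_ring V :: 'k mpoly ring"
  interpret R: cring ?R by (rule cring_mpoly_ring)
  have HR: "monom ` H \<subseteq> carrier ?R"
    using H monomials_carrier[of V] by (auto simp: monomials_def)
  have M_mult: "q * p \<in> ?M" if p: "p \<in> ?M" and q: "q \<in> carrier ?R" for p q
  proof -
    have "\<exists>h\<in>H. \<exists>d. c = h + d" if "c \<in> Poly_Mapping.keys (q * p)" for c
    proof -
      from that Poly_Mapping.keys_mult[of q p] obtain a b
        where ab: "c = a + b" "a \<in> Poly_Mapping.keys q" "b \<in> Poly_Mapping.keys p" by blast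
      from ab(3) p obtain h d where "h \<in> H" "b = h + d" by blast
      with ab(1) have "c = h + (a + d)" by (simp add: algebra_simps)
      with \<open>h \<in> H\<close> show ?thesis by blast
    qed
    moreover have "q * p \<in> carrier ?R"
      using R.m_closed[of q p] p q by (simp add: mpoly_ring_def)
    ultimately show ?thesis by blast
  qed
  have ideal_M: "ideal ?M ?R"
  proof (rule idealI)
    show "ring ?R" ..
    show "subgroup ?M (add_monoid ?R)"
    proof (rule R.add.subgroupI)
      show "?M \<subseteq> carrier ?R" by blast
      have "0 \<in> ?M" by (simp add: mpoly_ring_def)
      then show "?M \<noteq> {}" by blast
    next
      fix p assume p: "p \<in> ?M"
      then have "- p \<in> ?M" by (simp add: mpoly_ring_def)
      moreover have "\<ominus>\<^bsub>?R\<^esub> p = - p"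
        using calculation p by (intro R.minus_equality) (auto simp: mpoly_ring_def)
      ultimately show "\<ominus>\<^bsub>?R\<^esub> p \<in> ?M" by simp
    next
      fix p q assume pq: "p \<in> ?M" "q \<in> ?M"
      then have "p \<oplus>\<^bsub>?R\<^esub> q \<in> carrier ?R" by blast
      with pq show "p \<oplus>\<^bsub>?R\<^esub> q \<in> ?M"
        using Poly_Mapping.keys_add[of p q] by (auto simp: mpoly_ring_def)
    qed
  next
    fix p q assume "p \<in> ?M" "q \<in> carrier ?R"
    from M_mult[OF this] show "q \<otimes>\<^bsub>?R\<^esub> p \<in> ?M" "p \<otimes>\<^bsub>?R\<^esub> q \<in> ?M"
      by (simp_all add: mpoly_ring_def mult.commute)
  qed
  have "monom ` H \<subseteq> ?M"
  proof
    fix x :: "'k mpoly" assume x: "x \<in> monom ` H"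
    then obtain h where h: "h \<in> H" "x = monom h" by blast
    have "\<exists>h'\<in>H. \<exists>d. h = h' + d" using h(1) by (metis add.right_neutral)
    with h have "\<forall>a\<in>Poly_Mapping.keys x. \<exists>h\<in>H. \<exists>d. a = h + d"
      by (simp add: monom_def)
    with x HR show "x \<in> ?M" by blast
  qed
  then have "Idl\<^bsub>?R\<^esub> (monom ` H) \<subseteq> ?M" by (rule R.genideal_minimal[OF ideal_M])
  moreover have "p \<in> Idl\<^bsub>?R\<^esub> (monom ` H)" if p: "p \<in> ?M" for p
  proof -
    interpret I: ideal "Idl\<^bsub>?R\<^esub> (monom ` H)" ?R by (rule R.genideal_ideal[OF HR])
    have term_in: "Poly_Mapping.single a c \<in> Idl\<^bsub>?R\<^esub> (monom ` H)"
      if a: "a \<in> Poly_Mapping.keys p" for a and c :: 'k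
    proof -
      from p a obtain h d where h: "h \<in> H" "a = h + d" by blast
      moreover from p a have "Poly_Mapping.keys a \<subseteq> V" by (simp add: mpoly_ring_def)
      ultimately have "Poly_Mapping.keys d \<subseteq> V" by (simp add: keys_add_nat)
      then have "Poly_Mapping.single d c \<in> carrier ?R" by (auto simp: mpoly_ring_def)
      moreover have "monom h \<in> Idl\<^bsub>?R\<^esub> (monom ` H)" using R.genideal_self[OF HR] h by blast
      ultimately have "monom h \<otimes>\<^bsub>?R\<^esub> Poly_Mapping.single d c \<in> Idl\<^bsub>?R\<^esub> (monom ` H)"
        by (intro I.I_r_closed)
      then show ?thesis by (simp add: mpoly_ring_def monom_def mult_single h)
    qed
    have "(\<Sum>a\<in>A. Poly_Mapping.single a (Poly_Mapping.lookup p a)) \<in> Idl\<^bsub>?R\<^esub> (monom ` H)"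
      if "finite A" "A \<subseteq> Poly_Mapping.keys p" for A
      using that
    proof (induction A rule: finite_induct)
      case empty
      show ?case using I.zero_closed by (simp add: mpoly_ring_def)
    next
      case (insert a A)
      then show ?case
        using I.a_closed[OF term_in[of a "Poly_Mapping.lookup p a"]]
        by (simp add: mpoly_ring_def)
    qed
    from this[OF finite_keys order_refl]
    have "(\<Sum>a\<in>Poly_Mapping.keys p. Poly_Mapping.single a (Poly_Mapping.lookup p a))
      \<in> Idl\<^bsub>?R\<^esub> (monom ` H)" .
    moreover have "(\<Sum>a\<in>Poly_Mapping.keys p. Poly_Mapping.single a (Poly_Mapping.lookup p a)) = p"
      by (rule poly_mapping_eqI)
        (simp add: lookup_sum lookup_single when_def sum.delta in_keys_iff)
    ultimately show ?thesis by simp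
  qed
  ultimately show ?thesis by blast
qed

lemma monom_mem_Idl_iff:
  assumes "\<And>h. h \<in> H \<Longrightarrow> Poly_Mapping.keys h \<subseteq> V" and "Poly_Mapping.keys a \<subseteq> V"
  shows "monom a \<in> (Idl\<^bsub>mpoly_ring V\<^esub> (monom ` H) :: 'k::field mpoly set) \<longleftrightarrow>
    (\<exists>h\<in>H. \<exists>d. a = h + d)"
  using assms by (subst Idl_monom_image) (auto simp: monom_def mpoly_ring_def)

lemma monom_mem_Idl: "h \<in> H \<Longrightarrow> monom h \<in> Idl\<^bsub>mpoly_ring V\<^esub> (monom ` H)"
  unfolding genideal_def by blast

lemma Idl_monom_image_eqI:
  assumes "\<And>h. h \<in> H \<Longrightarrow> Poly_Mapping.keys h \<subseteq> V" and "H' \<subseteq> H"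
    and div: "\<And>h. h \<in> H \<Longrightarrow> \<exists>g\<in>H'. \<exists>d. h = g + d"
  shows "Idl\<^bsub>mpoly_ring V\<^esub> (monom ` H') = (Idl\<^bsub>mpoly_ring V\<^esub> (monom ` H) :: 'k::field mpoly set)"
proof -
  have "(\<exists>h\<in>H. \<exists>d. a = h + d) \<longleftrightarrow> (\<exists>h\<in>H'. \<exists>d. a = h + d)" for a
  proof
    assume "\<exists>h\<in>H. \<exists>d. a = h + d"
    then obtain h d where "h \<in> H" "a = h + d" by blast
    moreover from div[OF this(1)] obtain g d' where "g \<in> H'" "h = g + d'" by blast
    ultimately have "a = g + (d' + d)" by (simp add: add.assoc)
    with \<open>g \<in> H'\<close> show "\<exists>h\<in>H'. \<exists>d. a = h + d" by blast
  qed (use assms(2) in blast)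
  then show ?thesis using assms(1,2) by (subst (1 2) Idl_monom_image) auto
qed

lemma exponent_minimal_divisor:
  fixes H :: "(nat \<Rightarrow>\<^sub>0 nat) set"
  assumes "h \<in> H"
  shows "\<exists>g\<in>H. (\<exists>d. h = g + d) \<and> (\<forall>g'\<in>H. (\<exists>d. g = g' + d) \<longrightarrow> g' = g)"
proof -
  define sz :: "(nat \<Rightarrow>\<^sub>0 nat) \<Rightarrow> nat"
    where "sz a = (\<Sum>v\<in>Poly_Mapping.keys a. Poly_Mapping.lookup a v)" for a
  have sz_less: "sz a < sz (a + d)" if "d \<noteq> 0" for a d
  proof -
    from that obtain w where w: "w \<in> Poly_Mapping.keys d"
      by (metis ex_in_conv keys_eq_empty)
    have "sz a \<le> (\<Sum>v\<in>Poly_Mapping.keys (a + d). Poly_Mapping.lookup a v)"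
      unfolding sz_def by (rule sum_mono2) (auto simp: keys_add_nat)
    also have "\<dots> < sz (a + d)"
      unfolding sz_def using w
      by (intro sum_strict_mono_ex1)
        (auto simp: lookup_add in_keys_iff)
    finally show ?thesis .
  qed
  show ?thesis using assms
  proof (induction "sz h" arbitrary: h rule: less_induct)
    case less
    show ?case
    proof (cases "\<forall>g'\<in>H. (\<exists>d. h = g' + d) \<longrightarrow> g' = h")
      case True
      moreover have "h = h + 0" by simp
      ultimately show ?thesis using less.prems by blast
    next
      case False
      then obtain g' d where g': "g' \<in> H" "h = g' + d" "g' \<noteq> h" by blast
      then have "d \<noteq> 0" by auto
      with g' have "sz g' < sz h" by (simp add: sz_less)
      from less.hyps[OF this g'(1)] obtain g d'
        where g: "g \<in> H" "g' = g + d'" "\<forall>g'\<in>H. (\<exists>d. g = g' + d) \<longrightarrow> g' = g" by blast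
      with g' have "h = g + (d' + d)" by (simp add: add.assoc)
      with g show ?thesis by blast
    qed
  qed
qed

lemma exponent_antisym:
  fixes a b d e :: "nat \<Rightarrow>\<^sub>0 nat"
  assumes "a = b + d" "b = a + e"
  shows "a = b"
proof (rule poly_mapping_eqI)
  fix v
  have "Poly_Mapping.lookup a v = Poly_Mapping.lookup b v + Poly_Mapping.lookup d v"
    "Poly_Mapping.lookup b v = Poly_Mapping.lookup a v + Poly_Mapping.lookup e v"
    using arg_cong[OF assms(1), of "\<lambda>x. Poly_Mapping.lookup x v"]
      arg_cong[OF assms(2), of "\<lambda>x. Poly_Mapping.lookup x v"] by (simp_all add: lookup_add)
  then show "Poly_Mapping.lookup a v = Poly_Mapping.lookup b v" by linarith
qed

lemma monomials_subset_image:
  assumes "B \<subseteq> monomials V"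
  obtains H where "B = monom ` H" "\<And>h. h \<in> H \<Longrightarrow> Poly_Mapping.keys h \<subseteq> V"
  using assms unfolding monomials_def subset_image_iff by blast

lemma inj_monom: "inj (monom :: _ \<Rightarrow> 'k::field mpoly)"
proof (rule injI)
  fix a b assume "(monom a :: 'k mpoly) = monom b"
  then have "Poly_Mapping.keys (monom a :: 'k mpoly) = Poly_Mapping.keys (monom b :: 'k mpoly)" by simp
  then show "a = b" by (simp add: monom_def)
qed

lemma is_min_gens_subset:
  fixes I :: "'k::field mpoly set"
  assumes A: "is_min_gens V I A" and B: "is_min_gens V I B"
  shows "A \<subseteq> B"
proof -
  from A obtain H where H: "A = monom ` H" "\<And>h. h \<in> H \<Longrightarrow> Poly_Mapping.keys h \<subseteq> V"
    unfolding is_min_gens_def by (meson monomials_subset_image)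
  from B obtain K where K: "B = monom ` K" "\<And>h. h \<in> K \<Longrightarrow> Poly_Mapping.keys h \<subseteq> V"
    unfolding is_min_gens_def by (meson monomials_subset_image)
  have eq: "Idl\<^bsub>mpoly_ring V\<^esub> (monom ` H) = I" "Idl\<^bsub>mpoly_ring V\<^esub> (monom ` K) = I"
    using A B H K by (simp_all add: is_min_gens_def)
  have HK: "\<exists>k\<in>K. \<exists>d. h = k + d" if "h \<in> H" for h
  proof -
    have "(monom h :: 'k mpoly) \<in> Idl\<^bsub>mpoly_ring V\<^esub> (monom ` K)"
      unfolding eq(2) eq(1)[symmetric] using that by (rule monom_mem_Idl)
    then show ?thesis using monom_mem_Idl_iff[OF K(2) H(2)[OF that]] by blast
  qed
  have KH: "\<exists>h\<in>H. \<exists>d. k = h + d" if "k \<in> K" for k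
  proof -
    have "(monom k :: 'k mpoly) \<in> Idl\<^bsub>mpoly_ring V\<^esub> (monom ` H)"
      unfolding eq(1) eq(2)[symmetric] using that by (rule monom_mem_Idl)
    then show ?thesis using monom_mem_Idl_iff[OF H(2) K(2)[OF that]] by blast
  qed
  have "h \<in> K" if h: "h \<in> H" for h
  proof -
    obtain k d where k: "k \<in> K" "h = k + d" using HK[OF h] by blast
    obtain h' d' where h': "h' \<in> H" "k = h' + d'" using KH[OF k(1)] by blast
    have "h' = h"
    proof (rule ccontr)
      assume ne: "h' \<noteq> h"
      have "\<exists>g\<in>H - {h}. \<exists>d. g' = g + d" if "g' \<in> H" for g'
      proof (cases "g' = h")
        case True
        then have "g' = h' + (d' + d)" using k h' by (simp add: add.assoc)
        with ne h' show ?thesis by blast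
      next
        case False
        have "g' = g' + 0" by simp
        with False that show ?thesis by blast
      qed
      then have "Idl\<^bsub>mpoly_ring V\<^esub> (monom ` (H - {h})) = I"
        using Idl_monom_image_eqI[of H V "H - {h}"] H(2) eq(1) by auto
      moreover have "(monom h :: 'k mpoly) \<notin> monom ` (H - {h})"
        using inj_image_mem_iff[OF inj_monom] by blast
      then have "monom ` (H - {h}) \<subset> A"
        unfolding H(1) using h by blast
      ultimately show False using A by (simp add: is_min_gens_def)
    qed
    with h'(2) have "k = h + d'" by simp
    with k(2) have "h = k" by (rule exponent_antisym)
    with k show ?thesis by simp
  qed
  then show ?thesis using H K by blast
qed

lemma ex1_is_min_gens:
  fixes B :: "'k::field mpoly set"
  assumes "B \<subseteq> monomials V"
  shows "\<exists>!A. is_min_gens V (Idl\<^bsub>mpoly_ring V\<^esub> B) A"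
proof -
  obtain H where H: "B = monom ` H" "\<And>h. h \<in> H \<Longrightarrow> Poly_Mapping.keys h \<subseteq> V"
    using monomials_subset_image[OF assms] by blast
  define K where "K = {g \<in> H. \<forall>g'\<in>H. (\<exists>d. g = g' + d) \<longrightarrow> g' = g}"
  have KH: "K \<subseteq> H" by (auto simp: K_def)
  have KV: "\<And>h. h \<in> K \<Longrightarrow> Poly_Mapping.keys h \<subseteq> V" using KH H(2) by blast
  have "Idl\<^bsub>mpoly_ring V\<^esub> (monom ` K) = Idl\<^bsub>mpoly_ring V\<^esub> B"
    unfolding H(1)
  proof (intro Idl_monom_image_eqI H(2) KH)
    fix h assume "h \<in> H"
    from exponent_minimal_divisor[OF this] show "\<exists>g\<in>K. \<exists>d. h = g + d"
      unfolding K_def by blast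
  qed
  moreover have "Idl\<^bsub>mpoly_ring V\<^esub> B' \<noteq> Idl\<^bsub>mpoly_ring V\<^esub> B" if B': "B' \<subset> monom ` K" for B'
  proof
    assume eq: "Idl\<^bsub>mpoly_ring V\<^esub> B' = Idl\<^bsub>mpoly_ring V\<^esub> B"
    from B' obtain L where L: "L \<subseteq> K" "B' = monom ` L" by (meson psubset_imp_subset subset_image_iff)
    with B' obtain g where g: "g \<in> K" "g \<notin> L" by blast
    have "monom g \<in> Idl\<^bsub>mpoly_ring V\<^esub> B"
      unfolding H(1) using g KH by (intro monom_mem_Idl) blast
    then have "\<exists>h\<in>L. \<exists>d. g = h + d"
      using monom_mem_Idl_iff[of L V g] L(1) KV g(1) unfolding eq[symmetric] L(2) by blast
    with g L(1) show False by (auto simp: K_def)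
  qed
  moreover have "monom ` K \<subseteq> monomials V" using KV by (auto simp: monomials_def)
  ultimately have "is_min_gens V (Idl\<^bsub>mpoly_ring V\<^esub> B) (monom ` K)"
    by (simp add: is_min_gens_def)
  then show ?thesis using is_min_gens_subset by (metis subset_antisym)
qed

end

theory Submission
  imports Defs
begin

text \<open>Since a path is bipartite, \<open>J(P\<^sub>n)\<^sup>s\<close> is generated by the monomials whose exponent vectors are
  \<open>s\<close>-covers, i.e. put total weight at least \<open>s\<close> on every edge: an \<open>(s + 1)\<close>-cover \<open>a\<close> dominates the
  cover consisting of the even vertices of weight at least \<open>1\<close> and the odd vertices of weight at
  least \<open>s + 1\<close>, and subtracting this cover leaves an \<open>s\<close>-cover. An \<open>s\<close>-cover is minimal
  iff every vertex in its support lies on an edge of total weight exactly \<open>s\<close>. For a sum of \<open>s\<close>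
  minimal vertex covers this means that every vertex covered by one of them lies on an edge no
  summand covers twice. A vertex of a path has at most two edges, so if this fails at a vertex,
  it already fails there for two of the summands.\<close>

section \<open>Minimal generators and products of monomial ideals, in terms of exponents\<close>

definition min_exps :: "(nat \<Rightarrow>\<^sub>0 nat) set \<Rightarrow> (nat \<Rightarrow>\<^sub>0 nat) set"
  where "min_exps H = {g \<in> H. \<forall>g'\<in>H. (\<exists>d. g = g' + d) \<longrightarrow> g' = g}"

text \<open>Makes the definite description \<open>min_gens\<close> computable. Two monomial
  generating sets of one ideal divide each other: every generator in one is a multiple of some
  generator in the other. Irredundance makes \<open>K\<close> an antichain for divisibility, and an
  antichain in this position consists of the minimal elements of \<open>H\<close>.\<close>

lemma min_gens_Idl_monom:
  assumes H: "\<And>h. h \<in> H \<Longrightarrow> Poly_Mapping.keys h \<subseteq> V"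
  shows "min_gens V (Idl\<^bsub>mpoly_ring V\<^esub> (monom ` H)) = (monom ` min_exps H :: 'k::field mpoly set)"
proof -
  let ?I = "Idl\<^bsub>mpoly_ring V\<^esub> (monom ` H) :: 'k mpoly set"
  have sub: "monom ` H \<subseteq> (monomials V :: 'k mpoly set)"
    using H by (auto simp: monomials_def)
  have ex1: "\<exists>!A. is_min_gens V ?I A" by (rule ex1_is_min_gens[OF sub])
  then have mg: "is_min_gens V ?I (min_gens V ?I)"
    unfolding min_gens_def by (rule theI')
  then obtain K where K: "min_gens V ?I = monom ` K" "\<And>h. h \<in> K \<Longrightarrow> Poly_Mapping.keys h \<subseteq> V"
    unfolding is_min_gens_def by (meson monomials_subset_image)
  have eq: "(Idl\<^bsub>mpoly_ring V\<^esub> (monom ` K) :: 'k mpoly set) = ?I"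
    using mg K by (simp add: is_min_gens_def)
  have HK: "\<exists>k\<in>K. \<exists>d. h = k + d" if "h \<in> H" for h
  proof -
    have "(monom h :: 'k mpoly) \<in> Idl\<^bsub>mpoly_ring V\<^esub> (monom ` K)"
      unfolding eq using that by (rule monom_mem_Idl)
    then show ?thesis using monom_mem_Idl_iff[of K V h] K(2) H[OF that] by blast
  qed
  have KH: "\<exists>h\<in>H. \<exists>d. k = h + d" if "k \<in> K" for k
  proof -
    have "(monom k :: 'k mpoly) \<in> ?I"
      unfolding eq[symmetric] using that by (rule monom_mem_Idl)
    then show ?thesis using monom_mem_Idl_iff[of H V k] H K(2)[OF that] by blast
  qed
  \<comment> \<open>A generator with another one properly dividing it could be dropped without
    changing the ideal, against the irredundance in \<open>is_min_gens\<close>.\<close>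
  have K_antichain: "k' = k" if k: "k \<in> K" "k' \<in> K" "k = k' + d" for k k' d
  proof (rule ccontr)
    assume ne: "k' \<noteq> k"
    have "\<exists>g\<in>K - {k}. \<exists>d. h = g + d" if "h \<in> K" for h
      using that k ne by (metis Diff_iff add.right_neutral singletonD)
    then have "(Idl\<^bsub>mpoly_ring V\<^esub> (monom ` (K - {k})) :: 'k mpoly set) = ?I"
      using Idl_monom_image_eqI[of K V "K - {k}"] K(2) eq by auto
    moreover have "monom ` (K - {k}) \<subset> (monom ` K :: 'k mpoly set)"
      using k(1) by (simp add: image_set_diff[OF inj_monom] psubset_eq) blast
    ultimately show False
      using mg K(1) by (simp add: is_min_gens_def)
  qed
  have "K = min_exps H"
  proof (intro subset_antisym subsetI)
    fix k assume k: "k \<in> K"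
    \<comment> \<open>Below \<open>h\<close> lies some \<open>k'\<close> in \<open>K\<close>, which
      then divides \<open>k\<close> and equals it by the antichain property; so \<open>h\<close> is
      squeezed between \<open>k\<close> and \<open>k\<close>.\<close>
    have min: "h = k" if h: "h \<in> H" "k = h + d" for h d
    proof -
      obtain k' d' where k': "k' \<in> K" "h = k' + d'" using HK[OF h(1)] by blast
      then have "k = k' + (d' + d)" using h(2) by (simp add: add.assoc)
      then have "k' = k" by (rule K_antichain[OF k k'(1)])
      with k'(2) h(2) show "h = k" using exponent_antisym by metis
    qed
    with KH[OF k] have "k \<in> H" by metis
    with min show "k \<in> min_exps H" unfolding min_exps_def by blast
  next
    fix g assume g: "g \<in> min_exps H"
    then obtain k d where k: "k \<in> K" "g = k + d" using HK unfolding min_exps_def by blast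
    obtain h d' where h: "h \<in> H" "k = h + d'" using KH[OF k(1)] by blast
    have "g = h + (d' + d)" using k h by (simp add: add.assoc)
    with g h(1) have "h = g" unfolding min_exps_def by blast
    with h(2) k(2) have "g = k" using exponent_antisym by metis
    with k show "g \<in> K" by simp
  qed
  with K(1) show ?thesis by simp
qed

text \<open>Every exponent of \<open>p * q\<close> is a sum of an exponent of \<open>p\<close> and
  one of \<open>q\<close>, so the termwise membership criterion \<open>Idl_monom_image\<close>
  passes to products. Conversely \<open>monom (a + b)\<close> is itself a product of
  generators.\<close>

lemma ideal_prod_Idl_monom:
  assumes A: "\<And>a. a \<in> A \<Longrightarrow> Poly_Mapping.keys a \<subseteq> V"
    and B: "\<And>b. b \<in> B \<Longrightarrow> Poly_Mapping.keys b \<subseteq> V"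
  shows "ideal_prod (mpoly_ring V) (Idl\<^bsub>mpoly_ring V\<^esub> (monom ` A)) (Idl\<^bsub>mpoly_ring V\<^esub> (monom ` B))
    = (Idl\<^bsub>mpoly_ring V\<^esub> (monom ` {a + b |a b. a \<in> A \<and> b \<in> B}) :: 'k::field mpoly set)"
    (is "ideal_prod ?R ?I ?J = Idl\<^bsub>_\<^esub> (monom ` ?AB)")
proof -
  interpret R: cring ?R by (rule cring_mpoly_ring)
  have AB: "Poly_Mapping.keys c \<subseteq> V" if "c \<in> ?AB" for c
  proof -
    from that obtain a b where "c = a + b" "a \<in> A" "b \<in> B" by blast
    with A B show ?thesis by (simp add: keys_add_nat)
  qed
  have car: "monom ` H \<subseteq> carrier ?R" if "\<And>h. h \<in> H \<Longrightarrow> Poly_Mapping.keys h \<subseteq> V" for H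
    using that monomials_carrier[of V] by (auto simp: monomials_def)
  have I: "ideal ?I ?R" using car[OF A] by (rule R.genideal_ideal)
  have J: "ideal ?J ?R" using car[OF B] by (rule R.genideal_ideal)
  have L: "ideal (Idl\<^bsub>?R\<^esub> (monom ` ?AB)) ?R" using car[OF AB] by (rule R.genideal_ideal)
  show ?thesis
  proof
    show "ideal_prod ?R ?I ?J \<subseteq> Idl\<^bsub>?R\<^esub> (monom ` ?AB)"
    proof
      fix x assume "x \<in> ideal_prod ?R ?I ?J"
      then show "x \<in> Idl\<^bsub>?R\<^esub> (monom ` ?AB)"
      proof (induction x rule: ideal_prod.induct)
        case (prod p q)
        have p: "\<forall>a\<in>Poly_Mapping.keys p. \<exists>h\<in>A. \<exists>d. a = h + d"
          using prod(1) by (simp add: Idl_monom_image[OF A])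
        have q: "\<forall>a\<in>Poly_Mapping.keys q. \<exists>h\<in>B. \<exists>d. a = h + d"
          using prod(2) by (simp add: Idl_monom_image[OF B])
        have "\<exists>h\<in>?AB. \<exists>d. c = h + d" if c: "c \<in> Poly_Mapping.keys (p * q)" for c
        proof -
          from c Poly_Mapping.keys_mult[of p q] obtain x y
            where xy: "c = x + y" "x \<in> Poly_Mapping.keys p" "y \<in> Poly_Mapping.keys q" by blast
          from p xy(2) obtain a d where a: "a \<in> A" "x = a + d" by blast
          from q xy(3) obtain b e where b: "b \<in> B" "y = b + e" by blast
          have "c = (a + b) + (d + e)" using xy(1) a(2) b(2) by (simp add: ac_simps)
          with a(1) b(1) show ?thesis by blast
        qed
        moreover have "p \<otimes>\<^bsub>?R\<^esub> q \<in> carrier ?R"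
          using ideal.Icarr[OF I prod(1)] ideal.Icarr[OF J prod(2)] by (rule R.m_closed)
        ultimately show ?case
          by - (subst Idl_monom_image, erule AB, simp add: mpoly_ring_def)
      next
        case (sum x y)
        then show ?case
          using additive_subgroup.a_closed[OF ideal.axioms(1)[OF L]] by blast
      qed
    qed
    show "Idl\<^bsub>?R\<^esub> (monom ` ?AB) \<subseteq> ideal_prod ?R ?I ?J"
    proof (rule R.genideal_minimal[OF R.ideal_prod_is_ideal[OF I J]], rule subsetI)
      fix x :: "'k mpoly" assume "x \<in> monom ` ?AB"
      then obtain a b where ab: "x = monom (a + b)" "a \<in> A" "b \<in> B" by blast
      then have "x = monom a \<otimes>\<^bsub>?R\<^esub> monom b"
        by (simp add: mpoly_ring_def monom_def mult_single)
      then show "x \<in> ideal_prod ?R ?I ?J"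
        using ab by (auto intro: ideal_prod.prod monom_mem_Idl)
    qed
  qed
qed

lemma monom_add: "monom (a + b) = (monom a * monom b :: 'k::field mpoly)"
  by (simp add: monom_def mult_single)

lemma monom_sum: "monom (\<Sum>k\<in>K. c k) = (\<Prod>k\<in>K. monom (c k) :: 'k::field mpoly)"
  by (induction K rule: infinite_finite_induct) (simp_all add: monom_add, simp_all add: monom_def)

section \<open>Covers of the path and the powers of its cover ideal\<close>

text \<open>These are the exponents of the monomials in the \<open>s\<close>-th symbolic power of
  the cover ideal, the intersection of the \<open>s\<close>-th powers of the edge primes. Weights
  are not bounded above, so the set is closed under multiples within the ring.\<close>

definition fold_covers :: "nat \<Rightarrow> nat \<Rightarrow> (nat \<Rightarrow>\<^sub>0 nat) set"
  where "fold_covers n s = {a. Poly_Mapping.keys a \<subseteq> {1..n} \<and>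
    (\<forall>v. 1 \<le> v \<and> v < n \<longrightarrow> s \<le> Poly_Mapping.lookup a v + Poly_Mapping.lookup a (v + 1))}"

lemma fold_covers_keys: "a \<in> fold_covers n s \<Longrightarrow> Poly_Mapping.keys a \<subseteq> {1..n}"
  by (simp add: fold_covers_def)

lemma fold_covers_edge:
  "a \<in> fold_covers n s \<Longrightarrow> 1 \<le> v \<Longrightarrow> v < n \<Longrightarrow>
    s \<le> Poly_Mapping.lookup a v + Poly_Mapping.lookup a (v + 1)"
  by (simp add: fold_covers_def)

lemma fold_covers_left_edge:
  "a \<in> fold_covers n s \<Longrightarrow> 1 < v \<Longrightarrow> v \<le> n \<Longrightarrow>
    s \<le> Poly_Mapping.lookup a (v - 1) + Poly_Mapping.lookup a v"
  using fold_covers_edge[of a n s "v - 1"] by simp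

lemma fold_covers_add:
  assumes "a \<in> fold_covers n s" and "b \<in> fold_covers n t"
  shows "a + b \<in> fold_covers n (s + t)"
proof -
  have "s + t \<le> Poly_Mapping.lookup (a + b) v + Poly_Mapping.lookup (a + b) (v + 1)"
    if "1 \<le> v" "v < n" for v
    using fold_covers_edge[OF assms(1) that] fold_covers_edge[OF assms(2) that]
    by (simp add: lookup_add)
  then show ?thesis
    using fold_covers_keys[OF assms(1)] fold_covers_keys[OF assms(2)]
    by (simp add: fold_covers_def keys_add_nat)
qed

lemma fold_covers_sum:
  assumes "finite K" and "\<And>k. k \<in> K \<Longrightarrow> c k \<in> fold_covers n 1"
  shows "(\<Sum>k\<in>K. c k) \<in> fold_covers n (card K)"
  using assms
proof (induction K rule: finite_induct)
  case empty
  show ?case by (simp add: fold_covers_def)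
next
  case (insert k K)
  then show ?case using fold_covers_add[of "c k" n 1 "\<Sum>k\<in>K. c k" "card K"] by simp
qed

text \<open>Drives the induction on the exponent in \<open>ideal_power_path_cover_ideal\<close>; it
  is the reason why ordinary and symbolic powers of the cover ideal agree.\<close>

lemma fold_covers_Suc_split:
  assumes a: "a \<in> fold_covers n (Suc s)"
  shows "\<exists>b\<in>fold_covers n s. \<exists>c\<in>fold_covers n 1. a = b + c"
proof -
  let ?a = "Poly_Mapping.lookup a"
  define T where "T = {v \<in> Poly_Mapping.keys a. even v \<or> Suc s \<le> ?a v}"
  define c :: "nat \<Rightarrow>\<^sub>0 nat" where "c = (\<Sum>v\<in>T. Poly_Mapping.single v 1)"
  have "finite T" by (simp add: T_def)
  then have c: "Poly_Mapping.lookup c v = (if v \<in> T then 1 else 0)" for v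
    by (simp add: c_def lookup_sum lookup_single when_def sum.delta)
  have T: "v \<in> T \<longleftrightarrow> 1 \<le> ?a v \<and> (even v \<or> Suc s \<le> ?a v)" for v
    by (auto simp: T_def in_keys_iff)
  \<comment> \<open>This makes the truncated subtraction \<open>a - c\<close> exact.\<close>
  have le: "Poly_Mapping.lookup c v \<le> ?a v" for v
    using T[of v] by (simp add: c)
  have sum: "a = (a - c) + c"
    by (rule poly_mapping_eqI) (simp add: lookup_add lookup_minus le)
  have keys: "Poly_Mapping.keys (a - c) \<subseteq> {1..n}" "Poly_Mapping.keys c \<subseteq> {1..n}"
    using fold_covers_keys[OF a] arg_cong[OF sum, of Poly_Mapping.keys]
    unfolding keys_add_nat by blast+
  \<comment> \<open>Each edge has one even and one odd end. If the even end is not in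
    \<open>T\<close>, its weight in \<open>a\<close> is \<open>0\<close>, so the odd end has weight
    at least \<open>s + 1\<close> and is in \<open>T\<close>. If both ends are in \<open>T\<close>,
    the odd end alone keeps weight at least \<open>s\<close>; otherwise the edge loses only
    \<open>1\<close>.\<close>
  have edge: "1 \<le> Poly_Mapping.lookup c v + Poly_Mapping.lookup c (v + 1)
      \<and> s \<le> (?a v - Poly_Mapping.lookup c v) + (?a (v + 1) - Poly_Mapping.lookup c (v + 1))"
    if v: "1 \<le> v" "v < n" for v
    using fold_covers_edge[OF a v] by (cases "even v") (auto simp: c T)
  have "a - c \<in> fold_covers n s" "c \<in> fold_covers n 1"
    using keys edge by (simp_all add: fold_covers_def lookup_minus)
  with sum show ?thesis by blast
qed

text \<open>Membership in each edge ideal is a condition on the single terms, so the intersection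
  collects the polynomials all of whose exponents are \<open>1\<close>-covers. Without edges both
  sides are the whole ring.\<close>

lemma path_cover_ideal_eq:
  "path_cover_ideal n = (Idl\<^bsub>mpoly_ring {1..n}\<^esub> (monom ` fold_covers n 1) :: 'k::field mpoly set)"
proof -
  let ?R = "mpoly_ring {1..n} :: 'k mpoly ring"
  have div_var: "(\<exists>d. a = Poly_Mapping.single v 1 + d) \<longleftrightarrow> 1 \<le> Poly_Mapping.lookup a v"
    for a :: "nat \<Rightarrow>\<^sub>0 nat" and v
  proof
    assume "1 \<le> Poly_Mapping.lookup a v"
    then have "a = Poly_Mapping.single v 1 + (a - Poly_Mapping.single v 1)"
      by (intro poly_mapping_eqI) (auto simp: lookup_add lookup_minus lookup_single when_def)
    then show "\<exists>d. a = Poly_Mapping.single v 1 + d" by blast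
  qed (auto simp: lookup_add)
  have edge: "Idl\<^bsub>?R\<^esub> (var ` {v, v + 1}) =
      {p \<in> carrier ?R. \<forall>a\<in>Poly_Mapping.keys p.
        1 \<le> Poly_Mapping.lookup a v + Poly_Mapping.lookup a (v + 1)}"
    if v: "1 \<le> v" "v < n" for v
  proof -
    have "var ` {v, v + 1} =
        (monom ` {Poly_Mapping.single v 1, Poly_Mapping.single (v + 1) 1} :: 'k mpoly set)"
      by (simp add: var_def)
    then show ?thesis
      using v by (simp only:, subst Idl_monom_image) (auto simp: div_var[unfolded One_nat_def])
  qed
  have up: "(\<exists>h\<in>fold_covers n 1. \<exists>d. a = h + d) \<longleftrightarrow> a \<in> fold_covers n 1"
    if "Poly_Mapping.keys a \<subseteq> {1..n}" for a
  proof
    assume "\<exists>h\<in>fold_covers n 1. \<exists>d. a = h + d"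
    then obtain h d where h: "h \<in> fold_covers n 1" "a = h + d" by blast
    \<comment> \<open>A \<open>0\<close>-cover is any exponent supported on the vertices, so closure
      under multiples is an instance of \<open>fold_covers_add\<close>.\<close>
    with that have "d \<in> fold_covers n 0" by (simp add: fold_covers_def keys_add_nat)
    from fold_covers_add[OF h(1) this] h(2) show "a \<in> fold_covers n 1" by simp
  qed (metis add.right_neutral)
  have "path_edges n = (\<lambda>v. {v, v + 1}) ` {v. 1 \<le> v \<and> v < n}"
  proof -
    have "(1 \<le> v \<and> v \<le> n - 1) \<longleftrightarrow> (1 \<le> v \<and> v < n)" for v by auto
    then show ?thesis by (simp add: path_edges_def image_Collect)
  qed
  then have "path_cover_ideal n =
      carrier ?R \<inter> (\<Inter>v\<in>{v. 1 \<le> v \<and> v < n}. Idl\<^bsub>?R\<^esub> (var ` {v, v + 1}))"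
    by (simp add: path_cover_ideal_def cover_ideal_def)
  also have "\<dots> = {p \<in> carrier ?R. \<forall>a\<in>Poly_Mapping.keys p. a \<in> fold_covers n 1}"
    using edge by (auto simp: fold_covers_def mpoly_ring_def)
  also have "\<dots> = Idl\<^bsub>?R\<^esub> (monom ` fold_covers n 1)"
    using up by - (subst Idl_monom_image, erule fold_covers_keys, auto simp: mpoly_ring_def)
  finally show ?thesis .
qed

text \<open>The sums of an \<open>s\<close>-cover and a \<open>1\<close>-cover are exactly the
  \<open>(s + 1)\<close>-covers, by \<open>fold_covers_add\<close> and
  \<open>fold_covers_Suc_split\<close>.\<close>

lemma ideal_power_path_cover_ideal:
  "ideal_power {1..n} (path_cover_ideal n) s =
    (Idl\<^bsub>mpoly_ring {1..n}\<^esub> (monom ` fold_covers n s) :: 'k::field mpoly set)"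
proof (induction s)
  case 0
  \<comment> \<open>The zeroth power is the whole ring, and the exponent \<open>0\<close> divides
    every other.\<close>
  have zero: "0 \<in> fold_covers n 0" by (simp add: fold_covers_def)
  have "\<exists>h\<in>fold_covers n 0. \<exists>d. a = h + d" for a
    using zero by (metis add.left_neutral)
  then show ?case
    by - (subst Idl_monom_image, erule fold_covers_keys, simp add: ideal_power_def ideals_set_def)
next
  case (Suc s)
  have "{a + b |a b. a \<in> fold_covers n s \<and> b \<in> fold_covers n 1} = fold_covers n (Suc s)"
    using fold_covers_add[of _ n s _ 1] fold_covers_Suc_split[of _ n s] by fastforce
  moreover have "ideal_prod (mpoly_ring {1..n}) (Idl\<^bsub>mpoly_ring {1..n}\<^esub> (monom ` fold_covers n s))
      (Idl\<^bsub>mpoly_ring {1..n}\<^esub> (monom ` fold_covers n 1)) =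
    (Idl\<^bsub>mpoly_ring {1..n}\<^esub> (monom ` {a + b |a b. a \<in> fold_covers n s \<and> b \<in> fold_covers n 1})
      :: 'k mpoly set)"
    by (rule ideal_prod_Idl_monom) (erule fold_covers_keys)+
  ultimately show ?case
    using Suc by (simp add: ideal_power_def ideals_set_def path_cover_ideal_eq)
qed

section \<open>Minimal covers and tight edges\<close>

text \<open>Lowering the weight of \<open>v\<close> by \<open>1\<close> affects only the edges at
  \<open>v\<close>, and is possible iff none of them is tight. The guards \<open>v < n\<close> and
  \<open>1 < v\<close> keep the nonexistent edges beyond the ends of the path from counting as
  tight.\<close>

lemma min_exps_fold_covers_iff:
  assumes a: "a \<in> fold_covers n s"
  shows "a \<in> min_exps (fold_covers n s) \<longleftrightarrow> (\<forall>v\<in>Poly_Mapping.keys a.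
    v < n \<and> Poly_Mapping.lookup a v + Poly_Mapping.lookup a (v + 1) = s \<or>
    1 < v \<and> Poly_Mapping.lookup a (v - 1) + Poly_Mapping.lookup a v = s)"
    (is "_ \<longleftrightarrow> (\<forall>v\<in>_. ?tight v)")
proof (intro iffI ballI)
  fix v assume min: "a \<in> min_exps (fold_covers n s)" and v: "v \<in> Poly_Mapping.keys a"
  show "?tight v"
  proof (rule ccontr)
    assume nt: "\<not> ?tight v"
    define g where "g = a - Poly_Mapping.single v 1"
    have g: "Poly_Mapping.lookup g w = Poly_Mapping.lookup a w - (if w = v then 1 else 0)" for w
      by (simp add: g_def lookup_minus lookup_single when_def)
    have pos: "1 \<le> Poly_Mapping.lookup a v" using v by (simp add: in_keys_iff)
    have sum: "a = g + Poly_Mapping.single v 1"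
      using pos by (intro poly_mapping_eqI) (auto simp: g lookup_add lookup_single when_def)
    have "s \<le> Poly_Mapping.lookup g w + Poly_Mapping.lookup g (w + 1)" if w: "1 \<le> w" "w < n" for w
      using fold_covers_edge[OF a w] nt w pos by (auto simp: g)
    moreover have "Poly_Mapping.keys g \<subseteq> {1..n}"
      using fold_covers_keys[OF a] arg_cong[OF sum, of Poly_Mapping.keys]
      unfolding keys_add_nat by blast
    ultimately have "g \<in> fold_covers n s" by (simp add: fold_covers_def)
    with min sum have "g = a" unfolding min_exps_def by blast
    with g[of v] pos show False by simp
  qed
next
  assume tight: "\<forall>v\<in>Poly_Mapping.keys a. ?tight v"
  have "g = a" if g: "g \<in> fold_covers n s" and sum: "a = g + d" for g d
  proof (rule ccontr)
    assume "g \<noteq> a"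
    with sum obtain v where v: "v \<in> Poly_Mapping.keys d"
      by (metis add.right_neutral ex_in_conv keys_eq_empty)
    have "v \<in> Poly_Mapping.keys a" using v sum by (simp add: keys_add_nat)
    with tight fold_covers_keys[OF a] have t: "?tight v" and "1 \<le> v" "v \<le> n" by auto
    moreover have "Poly_Mapping.lookup g v < Poly_Mapping.lookup a v"
      using v sum by (simp add: lookup_add in_keys_iff)
    moreover have "Poly_Mapping.lookup g w \<le> Poly_Mapping.lookup a w" for w
      using sum by (simp add: lookup_add)
    then have "Poly_Mapping.lookup g (v + 1) \<le> Poly_Mapping.lookup a (v + 1)"
      "Poly_Mapping.lookup g (v - 1) \<le> Poly_Mapping.lookup a (v - 1)" by blast+
    ultimately show False
      using fold_covers_edge[OF g, of v] fold_covers_left_edge[OF g, of v] by auto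
  qed
  with a show "a \<in> min_exps (fold_covers n s)" unfolding min_exps_def by blast
qed

section \<open>Sums of minimal vertex covers\<close>

text \<open>The sum exceeds \<open>card K\<close> by the total of the excesses
  \<open>f k - 1\<close>. Applied to the weights of the summands on one edge.\<close>

lemma sum_eq_card_iff:
  fixes f :: "'a \<Rightarrow> nat"
  assumes "finite K" and "\<And>k. k \<in> K \<Longrightarrow> 1 \<le> f k"
  shows "sum f K = card K \<longleftrightarrow> (\<forall>k\<in>K. f k = 1)"
proof -
  have "sum f K = card K + (\<Sum>k\<in>K. f k - 1)"
    unfolding card_eq_sum sum.distrib[symmetric] using assms(2) by (intro sum.cong) (simp_all del: One_nat_def)
  also have "\<dots> = card K \<longleftrightarrow> (\<forall>k\<in>K. f k - 1 = 0)"
    using assms(1) by simp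
  finally show ?thesis using assms(2) by (metis diff_is_0_eq le_antisym order_refl)
qed

lemma sum_min_exps_fold_covers_iff:
  assumes fin: "finite K" and min: "\<And>k. k \<in> K \<Longrightarrow> c k \<in> min_exps (fold_covers n 1)"
  shows "(\<Sum>k\<in>K. c k) \<in> min_exps (fold_covers n (card K)) \<longleftrightarrow>
    (\<forall>v\<in>(\<Union>k\<in>K. Poly_Mapping.keys (c k)).
      v < n \<and> (\<forall>k\<in>K. Poly_Mapping.lookup (c k) v + Poly_Mapping.lookup (c k) (v + 1) = 1) \<or>
      1 < v \<and> (\<forall>k\<in>K. Poly_Mapping.lookup (c k) (v - 1) + Poly_Mapping.lookup (c k) v = 1))"
proof -
  have cov: "c k \<in> fold_covers n 1" if "k \<in> K" for k
    using min[OF that] by (simp add: min_exps_def)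
  have keys: "Poly_Mapping.keys (\<Sum>k\<in>K. c k) = (\<Union>k\<in>K. Poly_Mapping.keys (c k))"
    using fin by (auto simp: in_keys_iff lookup_sum)
  have edge: "Poly_Mapping.lookup (\<Sum>k\<in>K. c k) v + Poly_Mapping.lookup (\<Sum>k\<in>K. c k) (v + 1) = card K
    \<longleftrightarrow> (\<forall>k\<in>K. Poly_Mapping.lookup (c k) v + Poly_Mapping.lookup (c k) (v + 1) = 1)"
    if "1 \<le> v" "v < n" for v
    using sum_eq_card_iff[OF fin fold_covers_edge[OF cov that]]
    by (simp add: lookup_sum sum.distrib)
  have range: "1 \<le> v \<and> v \<le> n" if "v \<in> (\<Union>k\<in>K. Poly_Mapping.keys (c k))" for v
    using that fold_covers_keys[OF cov] by fastforce
  have "(\<Sum>k\<in>K. c k) \<in> fold_covers n (card K)"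
    using fold_covers_sum[OF fin] cov by blast
  then show ?thesis
    unfolding min_exps_fold_covers_iff[OF \<open>(\<Sum>k\<in>K. c k) \<in> fold_covers n (card K)\<close>] keys
  proof (intro ball_cong refl)
    fix v assume "v \<in> (\<Union>k\<in>K. Poly_Mapping.keys (c k))"
    then have "1 \<le> v" "v \<le> n" using range by blast+
    \<comment> \<open>The left edge of \<open>v\<close> is the edge starting at
      \<open>v - 1\<close>; these facts allow \<open>edge\<close> to be instantiated there.\<close>
    moreover have "1 \<le> v - 1" "v - 1 < n" "v - 1 + 1 = v" if "1 < v"
      using that \<open>v \<le> n\<close> by auto
    ultimately show "(v < n \<and> Poly_Mapping.lookup (\<Sum>k\<in>K. c k) v
          + Poly_Mapping.lookup (\<Sum>k\<in>K. c k) (v + 1) = card K \<or>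
        1 < v \<and> Poly_Mapping.lookup (\<Sum>k\<in>K. c k) (v - 1)
          + Poly_Mapping.lookup (\<Sum>k\<in>K. c k) v = card K) \<longleftrightarrow>
      (v < n \<and> (\<forall>k\<in>K. Poly_Mapping.lookup (c k) v + Poly_Mapping.lookup (c k) (v + 1) = 1) \<or>
        1 < v \<and> (\<forall>k\<in>K. Poly_Mapping.lookup (c k) (v - 1) + Poly_Mapping.lookup (c k) v = 1))"
      using edge[of v] edge[of "v - 1"] by metis
  qed
qed

text \<open>A tight edge has total weight \<open>1\<close>, which bounds the weight of its ends; off
  the support the weight is \<open>0\<close>.\<close>

lemma min_exps_fold_covers_1_le:
  assumes "a \<in> min_exps (fold_covers n 1)"
  shows "Poly_Mapping.lookup a v \<le> 1"
proof (cases "v \<in> Poly_Mapping.keys a")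
  case True
  have "a \<in> fold_covers n 1" using assms by (simp add: min_exps_def)
  from min_exps_fold_covers_iff[OF this] assms True show ?thesis by force
qed (simp add: in_keys_iff)

lemma add_min_exps_fold_covers_iff:
  assumes a: "a \<in> min_exps (fold_covers n 1)" and b: "b \<in> min_exps (fold_covers n 1)"
  shows "a + b \<in> min_exps (fold_covers n 2) \<longleftrightarrow>
    (\<forall>v\<in>Poly_Mapping.keys a \<union> Poly_Mapping.keys b.
      v < n \<and> (\<forall>x\<in>{a, b}. Poly_Mapping.lookup x v + Poly_Mapping.lookup x (v + 1) = 1) \<or>
      1 < v \<and> (\<forall>x\<in>{a, b}. Poly_Mapping.lookup x (v - 1) + Poly_Mapping.lookup x v = 1))"
  \<comment> \<open>Indexing by booleans keeps two summands even when \<open>a = b\<close>.\<close>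
  using sum_min_exps_fold_covers_iff[of "{True, False}" "\<lambda>k. if k then a else b" n] a b
  by (simp add: numeral_2_eq_2 ex_bool_eq)

text \<open>If neither edge at \<open>v\<close> is tight for the sum, one summand spoils the right
  edge and one the left edge, and this pair already violates the pairwise condition. Pairs with
  \<open>k = l\<close> settle the case where \<open>v\<close> has no edge.\<close>

lemma sum_min_exps_fold_covers_iff_pairs:
  assumes fin: "finite K" and min: "\<And>k. k \<in> K \<Longrightarrow> c k \<in> min_exps (fold_covers n 1)"
  shows "(\<Sum>k\<in>K. c k) \<in> min_exps (fold_covers n (card K)) \<longleftrightarrow>
    (\<forall>k\<in>K. \<forall>l\<in>K. c k + c l \<in> min_exps (fold_covers n 2))"
proof -
  define right where "right v k \<longleftrightarrow>
    v < n \<and> Poly_Mapping.lookup (c k) v + Poly_Mapping.lookup (c k) (v + 1) = 1" for v k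
  define left where "left v k \<longleftrightarrow>
    1 < v \<and> Poly_Mapping.lookup (c k) (v - 1) + Poly_Mapping.lookup (c k) v = 1" for v k
  have all: "(\<Sum>k\<in>K. c k) \<in> min_exps (fold_covers n (card K)) \<longleftrightarrow>
      (\<forall>m\<in>K. \<forall>v\<in>Poly_Mapping.keys (c m). (\<forall>k\<in>K. right v k) \<or> (\<forall>k\<in>K. left v k))"
  proof -
    have "(\<Sum>k\<in>K. c k) \<in> min_exps (fold_covers n (card K)) \<longleftrightarrow> (\<forall>m\<in>K. \<forall>v\<in>Poly_Mapping.keys (c m).
      v < n \<and> (\<forall>k\<in>K. Poly_Mapping.lookup (c k) v + Poly_Mapping.lookup (c k) (v + 1) = 1) \<or>
      1 < v \<and> (\<forall>k\<in>K. Poly_Mapping.lookup (c k) (v - 1) + Poly_Mapping.lookup (c k) v = 1))"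
      using sum_min_exps_fold_covers_iff[OF fin, of c n] min by simp
    also have "\<dots> \<longleftrightarrow>
        (\<forall>m\<in>K. \<forall>v\<in>Poly_Mapping.keys (c m). (\<forall>k\<in>K. right v k) \<or> (\<forall>k\<in>K. left v k))"
      by (intro ball_cong refl) (auto simp: right_def left_def)
    finally show ?thesis .
  qed
  have pair: "c k + c l \<in> min_exps (fold_covers n 2) \<longleftrightarrow>
      (\<forall>v\<in>Poly_Mapping.keys (c k) \<union> Poly_Mapping.keys (c l).
        right v k \<and> right v l \<or> left v k \<and> left v l)" if "k \<in> K" "l \<in> K" for k l
    unfolding add_min_exps_fold_covers_iff[OF min[OF that(1)] min[OF that(2)]]
      right_def left_def by blast
  \<comment> \<open>A cover avoiding \<open>v\<close> must contain the other end of every edge at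
    \<open>v\<close>, with weight exactly \<open>1\<close> by minimality.\<close>
  have off: "(v < n \<longrightarrow> right v k) \<and> (1 < v \<longrightarrow> left v k)"
    if k: "k \<in> K" "v \<notin> Poly_Mapping.keys (c k)" and v: "1 \<le> v" "v \<le> n" for v k
  proof -
    have "c k \<in> fold_covers n 1" using min[OF k(1)] by (simp add: min_exps_def)
    moreover have "Poly_Mapping.lookup (c k) v = 0" using k(2) by (simp add: in_keys_iff)
    ultimately have "v < n \<Longrightarrow> Poly_Mapping.lookup (c k) v + Poly_Mapping.lookup (c k) (v + 1) = 1"
      "1 < v \<Longrightarrow> Poly_Mapping.lookup (c k) (v - 1) + Poly_Mapping.lookup (c k) v = 1"
      using v fold_covers_edge[of "c k" n 1 v] fold_covers_left_edge[of "c k" n 1 v]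
        min_exps_fold_covers_1_le[OF min[OF k(1)], of "v + 1"]
        min_exps_fold_covers_1_le[OF min[OF k(1)], of "v - 1"]
      by linarith+
    then show ?thesis unfolding right_def left_def by blast
  qed
  have "(\<forall>k\<in>K. right v k) \<or> (\<forall>k\<in>K. left v k)"
    if pairs: "\<forall>k\<in>K. \<forall>l\<in>K. c k + c l \<in> min_exps (fold_covers n 2)"
      and v: "m \<in> K" "v \<in> Poly_Mapping.keys (c m)" for m v
  proof (rule ccontr)
    assume "\<not> ?thesis"
    then obtain k l where k: "k \<in> K" "\<not> right v k" and l: "l \<in> K" "\<not> left v l" by blast
    have "c m \<in> fold_covers n 1" using min[OF v(1)] by (simp add: min_exps_def)
    then have range: "1 \<le> v" "v \<le> n" using fold_covers_keys v(2) by fastforce+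
    \<comment> \<open>Were \<open>v\<close> in either support, the pair \<open>k\<close>,
      \<open>l\<close> would share a tight edge at \<open>v\<close>, but \<open>k\<close> fails on
      the right and \<open>l\<close> on the left.\<close>
    have "v \<notin> Poly_Mapping.keys (c k)" "v \<notin> Poly_Mapping.keys (c l)"
      using pairs pair[OF k(1) l(1)] k l by blast+
    \<comment> \<open>By \<open>off\<close> these two covers cannot fail on an existing edge, so
      \<open>v\<close> has no edges.\<close>
    then have "\<not> v < n" "\<not> 1 < v"
      using off[OF k(1) _ range] off[OF l(1) _ range] k(2) l(2) by blast+
    \<comment> \<open>The pair of \<open>m\<close> with itself still requires an edge at
      \<open>v\<close>.\<close>
    then show False
      using pairs pair[OF v(1) v(1)] v by (auto simp: right_def left_def)
  qed
  then show ?thesis unfolding all using pair by blast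
qed

section \<open>From exponents back to monomials\<close>

theorem corollary3p12:
  fixes n r s :: nat and u :: "nat \<Rightarrow> 'k::field mpoly" and i :: "nat \<Rightarrow> nat"
  assumes "n \<ge> 1"
    and "bij_betw u {1..r} (min_gens {1..n} (path_cover_ideal n))"
    and "s \<ge> 2"
    and "\<forall>j\<in>{1..s}. i j \<in> {1..r}"
  shows "(\<Prod>j=1..s. u (i j)) \<in> min_gens {1..n} (ideal_power {1..n} (path_cover_ideal n) s) \<longleftrightarrow>
    (\<forall>p\<in>i ` {1..s}. \<forall>q\<in>i ` {1..s}.
       u p * u q \<in> min_gens {1..n} (ideal_power {1..n} (path_cover_ideal n) 2))"
proof -
  have gens: "min_gens {1..n} (ideal_power {1..n} (path_cover_ideal n) t) =
      (monom ` min_exps (fold_covers n t) :: 'k mpoly set)" for t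
    unfolding ideal_power_path_cover_ideal by (rule min_gens_Idl_monom) (rule fold_covers_keys)
  have gens1: "min_gens {1..n} (path_cover_ideal n) =
      (monom ` min_exps (fold_covers n 1) :: 'k mpoly set)"
    unfolding path_cover_ideal_eq by (rule min_gens_Idl_monom) (rule fold_covers_keys)
  \<comment> \<open>Exponents are chosen per position \<open>j\<close>, so that a generator
    occurring several times is counted with multiplicity.\<close>
  have "\<forall>j\<in>{1..s}. \<exists>a. u (i j) = monom a \<and> a \<in> min_exps (fold_covers n 1)"
    using assms(2,4) unfolding gens1 bij_betw_def by blast
  then obtain c where c: "\<And>j. j \<in> {1..s} \<Longrightarrow> u (i j) = monom (c j)"
    "\<And>j. j \<in> {1..s} \<Longrightarrow> c j \<in> min_exps (fold_covers n 1)"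
    by metis
  \<comment> \<open>Injectivity of \<open>monom\<close> turns membership among generators into
    membership among exponents.\<close>
  have mem: "(monom a :: 'k mpoly) \<in> monom ` H \<longleftrightarrow> a \<in> H" for a H
    by (rule inj_image_mem_iff[OF inj_monom])
  have prod: "(\<Prod>j=1..s. u (i j)) = monom (\<Sum>j=1..s. c j)"
    unfolding monom_sum using c(1) by (rule prod.cong[OF refl])
  have pair: "u (i j) * u (i k) = monom (c j + c k)" if "j \<in> {1..s}" "k \<in> {1..s}" for j k
    using c(1)[OF that(1)] c(1)[OF that(2)] by (simp add: monom_add)
  have "(\<Prod>j=1..s. u (i j)) \<in> min_gens {1..n} (ideal_power {1..n} (path_cover_ideal n) s) \<longleftrightarrow>
      (\<forall>j\<in>{1..s}. \<forall>k\<in>{1..s}. c j + c k \<in> min_exps (fold_covers n 2))"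
    unfolding gens prod mem
    using sum_min_exps_fold_covers_iff_pairs[of "{1..s}" c n] c(2) by simp
  then show ?thesis
    unfolding gens by (simp add: pair mem)
qed

end
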